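(* For any non-negative integer $n$, the quantities $M_2(n), f_2(n), g_2(n), h_2(n), t_2(n)$ satisfy \begin{align*} M_2(n+1) ={}& M_2^3(n) - 3M_2(n)[g_2(n)+2h_2(n)+t_2(n)]^2 + 3[h_2(n)+t_2(n)][g_2(n)+2h_2(n)+t_2(n)]^2 - [h_2(n)+t_2(n)]^3,\\ f_2(n+1) ={}& f_2^3(n) + 6f_2^2(n)g_2(n) + 3f_2^2(n)h_2(n) + 9f_2(n)g_2^2(n) + 2g_2^3(n) + 6f_2(n)g_2(n)h_2(n),\\ g_2(n+1) ={}& f_2^2(n)g_2(n) + 2f_2^2(n)h_2(n) + 4f_2(n)g_2^2(n) + f_2^2(n)t_2(n) + 8f_2(n)g_2(n)h_2(n) \\ & + 3g_2^3(n) + 2f_2(n)g_2(n)t_2(n) + 2f_2(n)h_2^2(n) + 4g_2^2(n)h_2(n),\\ h_2(n+1) ={}& f_2(n)g_2^2(n) + 4f_2(n)g_2(n)h_2(n) + 2g_2^3(n) + 2f_2(n)g_2(n)t_2(n) + 7g_2^2(n)h_2(n) \\ & + 3f_2(n)h_2^2(n) + 2f_2(n)h_2(n)t_2(n) + 2g_2^2(n)t_2(n) + 4g_2(n)h_2^2(n),\\ t_2(n+1) ={}& g_2^3(n) + 6g_2^2(n)h_2(n) + 3g_2^2(n)t_2(n) + 9g_2(n)h_2^2(n) + 2h_2^3(n) + 6g_2(n)h_2(n)t_2(n). \end{align*} Here $x^k(n)$ means $(x(n))^k$.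
   Context: A dimer-monomer configuration on a finite graph $G$ is a placement of dimers on edges such that each vertex is covered by at most one dimer (i.e. a matching of $G$, not necessarily perfect, possibly empty); vertices not covered by a dimer are said to be occupied by monomers. $N_{DM}(G)$ is the number of such configurations (all weights are one). The two-dimensional Sierpinski gasket graph $SG_2(n)$, with three distinguished "outmost" vertices, is defined recursively. $SG_2(0)$ is a triangle (three vertices, three edges), all of whose vertices are outmost, labelled $1,2,3$. $SG_2(n+1)$ is obtained from three disjoint copies of $SG_2(n)$, labelled $1,2,3$, by identifying, for each pair $l\neq m$, the outmost vertex $m$ of copy $l$ with the outmost vertex $l$ of copy $m$; the outmost vertex $l$ of $SG_2(n+1)$ is the outmost vertex $l$ of copy $l$. $M_2(n)=N_{DM}(SG_2(n))$. $f_2(n)$ is the number of dimer-monomer configurations on $SG_2(n)$ in which all three outmost vertices are occupied by monomers. $g_2(n)$ is the number in which one specified outmost vertex is occupied by a dimer and the other two outmost vertices are occupied by monomers (by symmetry independent of which one). $h_2(n)$ is the number in which one specified outmost vertex is occupied by a monomer and the other two outmost vertices are occupied by dimers (by symmetry independent of which one). $t_2(n)$ is the number in which all three outmost vertices are occupied by dimers. An outmost vertex is "occupied by a dimer" if it is covered by some dimer; two outmost vertices occupied by dimers need not be covered by the same dimer. *)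

theory Defs
  imports Main
begin

type_synonym 'a ugraph = "'a set \<times> 'a set set"

definition verts :: "'a ugraph \<Rightarrow> 'a set" where
  "verts G = fst G"

definition edges :: "'a ugraph \<Rightarrow> 'a set set" where
  "edges G = snd G"

definition dm_config :: "'a ugraph \<Rightarrow> 'a set set \<Rightarrow> bool" where
  "dm_config G D \<longleftrightarrow>
     D \<subseteq> edges G \<and> (\<forall>v\<in>verts G. \<forall>e\<in>D. \<forall>e'\<in>D. v \<in> e \<longrightarrow> v \<in> e' \<longrightarrow> e = e')"

definition N_DM :: "'a ugraph \<Rightarrow> nat" where
  "N_DM G = card {D. dm_config G D}"

definition dimer_at :: "'a set set \<Rightarrow> 'a \<Rightarrow> bool" where
  "dimer_at D v \<longleftrightarrow> (\<exists>e\<in>D. v \<in> e)"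

definition monomer_at :: "'a set set \<Rightarrow> 'a \<Rightarrow> bool" where
  "monomer_at D v \<longleftrightarrow> \<not> dimer_at D v"

text \<open>
  The constructor \<open>Copy l v\<close> tags a vertex \<open>v\<close> as lying in copy \<open>l\<close>, so that the three
  copies used in the recursion are disjoint before gluing.
\<close>

datatype vertex = Corner nat | Copy nat vertex

definition labels :: "nat set" where
  "labels = {1, 2, 3}"

fun outmost :: "nat \<Rightarrow> nat \<Rightarrow> vertex" where
  "outmost 0 l = Corner l"
| "outmost (Suc n) l = Copy l (outmost n l)"

text \<open>
  \<open>glue n l v\<close> is the vertex into which \<open>v\<close> of copy \<open>l\<close> is sent by the identifications.
  The quotient is realised by representatives: of the two identified vertices
  \<open>Copy l (outmost n m)\<close> and \<open>Copy m (outmost n l)\<close>, the one in the copy with the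
  smaller label is kept. The lemma \<open>glue_eq_iff\<close> confirms that nothing else is identified.
\<close>

definition glue :: "nat \<Rightarrow> nat \<Rightarrow> vertex \<Rightarrow> vertex" where
  "glue n l v =
     (if \<exists>m<l. v = outmost n m then Copy (THE m. v = outmost n m) (outmost n l)
      else Copy l v)"

fun SG2 :: "nat \<Rightarrow> vertex ugraph" where
  "SG2 0 = (Corner ` labels, {{Corner l, Corner m} | l m. l \<in> labels \<and> m \<in> labels \<and> l \<noteq> m})"
| "SG2 (Suc n) =
     (\<Union>l\<in>labels. glue n l ` verts (SG2 n),
      \<Union>l\<in>labels. (\<lambda>e. glue n l ` e) ` edges (SG2 n))"

lemma outmost_inject [simp]: "outmost n l = outmost n m \<longleftrightarrow> l = m"
  by (cases n) (auto dest: arg_cong[where f = "\<lambda>v. case v of Copy l _ \<Rightarrow> l | Corner l \<Rightarrow> l"])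

lemma glue_outmost: "glue n l (outmost n m) = Copy (min l m) (outmost n (max l m))"
  by (auto simp: glue_def min_def max_def)

lemma glue_eq_iff:
  "glue n l v = glue n m w \<longleftrightarrow>
     (l = m \<and> v = w) \<or> (l \<noteq> m \<and> v = outmost n m \<and> w = outmost n l)"
  by (cases l m rule: linorder_cases) (auto simp: glue_def)

lemma outmost_in_verts: "l \<in> labels \<Longrightarrow> outmost n l \<in> verts (SG2 n)"
proof (induction n)
  case (Suc n)
  have "outmost (Suc n) l = glue n l (outmost n l)"
    by (simp add: glue_outmost)
  with Suc show ?case
    by (auto simp: verts_def)
qed (auto simp: verts_def)

definition M2 :: "nat \<Rightarrow> nat" where
  "M2 n = N_DM (SG2 n)"

definition f2 :: "nat \<Rightarrow> nat" where
  "f2 n = card {D. dm_config (SG2 n) D \<and> (\<forall>l\<in>labels. monomer_at D (outmost n l))}"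

text \<open>
  For \<open>g2\<close> and \<open>h2\<close> the label of the specified outmost vertex is kept as an argument.
\<close>

definition g2 :: "nat \<Rightarrow> nat \<Rightarrow> nat" where
  "g2 i n = card {D. dm_config (SG2 n) D \<and> dimer_at D (outmost n i) \<and>
                     (\<forall>l\<in>labels - {i}. monomer_at D (outmost n l))}"

definition h2 :: "nat \<Rightarrow> nat \<Rightarrow> nat" where
  "h2 i n = card {D. dm_config (SG2 n) D \<and> monomer_at D (outmost n i) \<and>
                     (\<forall>l\<in>labels - {i}. dimer_at D (outmost n l))}"

definition t2 :: "nat \<Rightarrow> nat" where
  "t2 n = card {D. dm_config (SG2 n) D \<and> (\<forall>l\<in>labels. dimer_at D (outmost n l))}"

end

theory Submission
  imports Defs "HOL-Library.FuncSet"
begin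

text \<open>
  A configuration on the glued graph is the same as a triple of configurations on the copies in
  which none of the three gluing vertices is covered from both sides. Each outmost vertex of the
  new graph lies in one copy only. Counting configurations by the set of covered outmost vertices
  therefore gives a recursion with \<open>3\<^sup>3 = 27\<close> terms, one for each choice of states at the
  gluing vertices. The recursion itself propagates the symmetry of the counts, and collecting its
  terms yields the polynomials for \<open>f\<close>, \<open>g\<close>, \<open>h\<close>, \<open>t\<close>; the one for \<open>M\<close> follows by
  substituting into \<open>M = f + 3g + 3h + t\<close>.
\<close>

section \<open>Edges of the Sierpinski gasket\<close>

lemma finite_labels [simp]: "finite labels"
  by (simp add: labels_def)

lemma inj_glue: "inj (glue n l)"
  by (auto simp: inj_def glue_eq_iff)

lemma edges_SG2_Suc: "edges (SG2 (Suc n)) = (\<Union>l\<in>labels. (`) (glue n l) ` edges (SG2 n))"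
  by (simp add: edges_def)

lemma verts_SG2_Suc: "verts (SG2 (Suc n)) = (\<Union>l\<in>labels. glue n l ` verts (SG2 n))"
  by (simp add: verts_def)

declare SG2.simps(2) [simp del]

lemma edge_subset_verts: "e \<in> edges (SG2 n) \<Longrightarrow> e \<subseteq> verts (SG2 n)"
proof (induction n arbitrary: e)
  case 0
  then show ?case by (auto simp: edges_def verts_def)
next
  case (Suc n)
  then show ?case unfolding edges_SG2_Suc verts_SG2_Suc by blast
qed

lemma card_edge: "e \<in> edges (SG2 n) \<Longrightarrow> card e = 2"
proof (induction n arbitrary: e)
  case 0
  then show ?case by (auto simp: edges_def card_2_iff)
next
  case (Suc n)
  then show ?case
    by (auto simp: edges_SG2_Suc card_image[OF inj_on_subset[OF inj_glue subset_UNIV]])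
qed

lemma finite_edges: "finite (edges (SG2 n))"
proof (induction n)
  case 0
  have "edges (SG2 0) \<subseteq> Pow (Corner ` labels)"
    by (auto simp: edges_def)
  then show ?case by (rule finite_subset) simp
next
  case (Suc n)
  then show ?case by (simp add: edges_SG2_Suc)
qed

text \<open>Every edge lies inside the vertex set, so a common point of two edges is always among
  the vertices over which \<open>dm_config\<close> quantifies.\<close>

lemma dm_config_SG2_iff:
  "dm_config (SG2 n) D \<longleftrightarrow>
     D \<subseteq> edges (SG2 n) \<and> (\<forall>e\<in>D. \<forall>e'\<in>D. e \<inter> e' \<noteq> {} \<longrightarrow> e = e')"
  unfolding dm_config_def using edge_subset_verts[of _ n] by blast

lemma finite_dm_configs: "finite {D. dm_config (SG2 n) D}"
  by (rule finite_subset[of _ "Pow (edges (SG2 n))"]) (auto simp: dm_config_SG2_iff finite_edges)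

text \<open>Two copies share a single vertex, so they have no edge in common.\<close>

lemma glue_edge_eq:
  assumes "e \<in> edges (SG2 n)" and "glue n l ` e = glue n m ` e'"
  shows "l = m \<and> e = e'"
proof -
  have "l = m"
  proof (rule ccontr)
    assume "l \<noteq> m"
    have "e \<subseteq> {outmost n m}"
    proof
      fix v assume "v \<in> e"
      then obtain w where "glue n l v = glue n m w"
        using assms(2) by (metis imageE imageI)
      with \<open>l \<noteq> m\<close> show "v \<in> {outmost n m}" by (simp add: glue_eq_iff)
    qed
    then have "card e \<le> 1" using card_mono[of "{outmost n m}" e] by simp
    with card_edge[OF assms(1)] show False by simp
  qed
  with assms(2) show ?thesis using inj_image_eq_iff[OF inj_glue] by auto
qed

lemma glue_edges_meet_iff:
  assumes "l \<noteq> m"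
  shows "glue n l ` e \<inter> glue n m ` e' \<noteq> {} \<longleftrightarrow> outmost n m \<in> e \<and> outmost n l \<in> e'"
proof
  assume "glue n l ` e \<inter> glue n m ` e' \<noteq> {}"
  then obtain v w where "v \<in> e" "w \<in> e'" "glue n l v = glue n m w" by blast
  with assms show "outmost n m \<in> e \<and> outmost n l \<in> e'" by (simp add: glue_eq_iff)
next
  assume *: "outmost n m \<in> e \<and> outmost n l \<in> e'"
  have "glue n l (outmost n m) = glue n m (outmost n l)"
    by (simp add: glue_eq_iff assms)
  with * show "glue n l ` e \<inter> glue n m ` e' \<noteq> {}" by blast
qed

section \<open>Joining configurations of the three copies\<close>

definition join :: "nat \<Rightarrow> (nat \<Rightarrow> vertex set set) \<Rightarrow> vertex set set" where
  "join n X = (\<Union>l\<in>labels. (`) (glue n l) ` X l)"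

text \<open>For \<open>l \<noteq> m\<close> the two outmost vertices named here become the same
  vertex under \<open>glue\<close>.\<close>

definition compatible :: "nat \<Rightarrow> (nat \<Rightarrow> vertex set set) \<Rightarrow> bool" where
  "compatible n X \<longleftrightarrow> (\<forall>l\<in>labels. \<forall>m\<in>labels. l \<noteq> m \<longrightarrow>
     \<not> (dimer_at (X l) (outmost n m) \<and> dimer_at (X m) (outmost n l)))"

text \<open>The outmost vertex \<open>l\<close> of copy \<open>l\<close> is identified with nothing,
  so only dimers of copy \<open>l\<close> can reach it.\<close>

lemma dimer_at_join:
  assumes "l \<in> labels"
  shows "dimer_at (join n X) (outmost (Suc n) l) \<longleftrightarrow> dimer_at (X l) (outmost n l)"
proof -
  have corner: "outmost (Suc n) l = glue n l (outmost n l)"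
    by (simp add: glue_outmost)
  have "glue n l (outmost n l) \<in> glue n m ` e \<longleftrightarrow> l = m \<and> outmost n l \<in> e" for m e
    by (auto simp: glue_eq_iff image_iff)
  then show ?thesis
    unfolding dimer_at_def join_def corner using assms by auto
qed

text \<open>A glued edge determines its copy and its original edge, so \<open>join\<close> can be
  undone copy by copy.\<close>

lemma glue_edge_in_join_iff:
  assumes "\<And>l. l \<in> labels \<Longrightarrow> X l \<subseteq> edges (SG2 n)" and "l \<in> labels" and "e \<in> edges (SG2 n)"
  shows "glue n l ` e \<in> join n X \<longleftrightarrow> e \<in> X l"
  using assms glue_edge_eq[of e n l] unfolding join_def by blast

text \<open>Inside one copy, injectivity of \<open>glue\<close> preserves and reflects meeting
  edges. Edges of different copies can meet only at the gluing vertex, which is what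
  \<open>compatible\<close> controls.\<close>

lemma dm_config_join_iff:
  assumes sub: "\<And>l. l \<in> labels \<Longrightarrow> X l \<subseteq> edges (SG2 n)"
  shows "dm_config (SG2 (Suc n)) (join n X) \<longleftrightarrow>
    (\<forall>l\<in>labels. dm_config (SG2 n) (X l)) \<and> compatible n X"
    (is "?L \<longleftrightarrow> ?R")
proof
  assume ?L
  then have disj: "e = e'" if "e \<in> join n X" "e' \<in> join n X" "e \<inter> e' \<noteq> {}" for e e'
    using that by (simp only: dm_config_SG2_iff) blast
  have glued: "glue n l ` e \<in> join n X" if "l \<in> labels" "e \<in> X l" for l e
    using that by (auto simp: join_def)
  have "dm_config (SG2 n) (X l)" if l: "l \<in> labels" for l
    unfolding dm_config_SG2_iff
  proof (intro conjI ballI impI)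
    show "X l \<subseteq> edges (SG2 n)" by (rule sub[OF l])
    fix e e' assume *: "e \<in> X l" "e' \<in> X l" "e \<inter> e' \<noteq> {}"
    then have "glue n l ` e = glue n l ` e'"
      by (intro disj glued l) auto
    then show "e = e'" by (simp add: inj_image_eq_iff[OF inj_glue])
  qed
  moreover have "compatible n X"
    unfolding compatible_def dimer_at_def
  proof (intro ballI impI notI, elim conjE bexE)
    fix l m e e'
    assume lm: "l \<in> labels" "m \<in> labels" "l \<noteq> m"
      and e: "e \<in> X l" "outmost n m \<in> e" and e': "e' \<in> X m" "outmost n l \<in> e'"
    have "glue n l ` e = glue n m ` e'"
      using lm e e' by (intro disj glued) (auto simp: glue_edges_meet_iff)
    \<comment> \<open>Equal glued edges would come from the same copy, contradicting
      \<open>l \<noteq> m\<close>.\<close>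
    with glue_edge_eq[of e n l m e'] sub e(1) lm show False by blast
  qed
  ultimately show ?R by blast
next
  assume R: ?R
  have "join n X \<subseteq> edges (SG2 (Suc n))"
    using sub unfolding join_def edges_SG2_Suc by blast
  moreover have "d = d'" if d: "d \<in> join n X" "d' \<in> join n X" "d \<inter> d' \<noteq> {}" for d d'
  proof -
    obtain l e where l: "l \<in> labels" "e \<in> X l" "d = glue n l ` e"
      using d(1) unfolding join_def by blast
    obtain m e' where m: "m \<in> labels" "e' \<in> X m" "d' = glue n m ` e'"
      using d(2) unfolding join_def by blast
    have "l = m"
    proof (rule ccontr)
      assume "l \<noteq> m"
      then have "outmost n m \<in> e" "outmost n l \<in> e'"
        using d(3) l m by (simp_all add: glue_edges_meet_iff)
      with R l m \<open>l \<noteq> m\<close> show False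
        unfolding compatible_def dimer_at_def by blast
    qed
    then have "e \<inter> e' \<noteq> {}"
      using d(3) unfolding l m by (simp flip: image_Int[OF inj_glue])
    with R l m \<open>l = m\<close> show "d = d'" unfolding dm_config_SG2_iff by blast
  qed
  ultimately show ?L unfolding dm_config_SG2_iff by blast
qed

text \<open>The domain consists of extensional functions because \<open>join\<close> does not see
  values outside \<open>labels\<close>.\<close>

lemma bij_betw_join:
  "bij_betw (join n)
     {X \<in> labels \<rightarrow>\<^sub>E {D. dm_config (SG2 n) D}. compatible n X}
     {D. dm_config (SG2 (Suc n)) D}"
    (is "bij_betw _ ?A ?B")
proof (rule bij_betw_imageI)
  have sub: "X l \<subseteq> edges (SG2 n)" if "X \<in> ?A" "l \<in> labels" for X l
    using that by (auto simp: PiE_iff dm_config_SG2_iff)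
  show "inj_on (join n) ?A"
  proof (rule inj_onI)
    fix X Y assume X: "X \<in> ?A" and Y: "Y \<in> ?A" and eq: "join n X = join n Y"
    have "X l = Y l" if l: "l \<in> labels" for l
    proof -
      have "e \<in> X l \<longleftrightarrow> e \<in> Y l" if "e \<in> edges (SG2 n)" for e
        using glue_edge_in_join_iff[where X = X, OF sub[OF X] l that]
          glue_edge_in_join_iff[where X = Y, OF sub[OF Y] l that] eq by simp
      with sub[OF X l] sub[OF Y l] show ?thesis by blast
    qed
    with X Y show "X = Y" by (blast intro: PiE_ext)
  qed
  show "join n ` ?A = ?B"
  proof
    show "join n ` ?A \<subseteq> ?B"
    proof
      fix D assume "D \<in> join n ` ?A"
      then obtain X where X: "X \<in> ?A" and D: "D = join n X" by blast
      show "D \<in> ?B"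
        using X dm_config_join_iff[where X = X, OF sub[OF X]] unfolding D
        by (simp add: PiE_iff)
    qed
    show "?B \<subseteq> join n ` ?A"
    proof
      fix D assume "D \<in> ?B"
      then have D: "dm_config (SG2 (Suc n)) D" by simp
      \<comment> \<open>The preimage of \<open>D\<close>: each copy receives the edges whose glued
        images lie in \<open>D\<close>.\<close>
      define X where "X = (\<lambda>l\<in>labels. {e \<in> edges (SG2 n). glue n l ` e \<in> D})"
      have "D \<subseteq> edges (SG2 (Suc n))"
        using D unfolding dm_config_SG2_iff by blast
      then have "\<exists>l\<in>labels. \<exists>e\<in>edges (SG2 n). d = glue n l ` e" if "d \<in> D" for d
        using that unfolding edges_SG2_Suc by blast
      then have join: "join n X = D"
        unfolding join_def X_def by fastforce
      have "(\<forall>l\<in>labels. dm_config (SG2 n) (X l)) \<and> compatible n X"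
        using D unfolding join[symmetric]
        by (subst (asm) dm_config_join_iff) (auto simp: X_def)
      then have "X \<in> ?A" by (auto simp: X_def)
      with join show "D \<in> join n ` ?A" by blast
    qed
  qed
qed

section \<open>Counting configurations by the state of the outmost vertices\<close>

definition state_configs :: "nat \<Rightarrow> bool \<Rightarrow> bool \<Rightarrow> bool \<Rightarrow> vertex set set set" where
  "state_configs n b1 b2 b3 = {D. dm_config (SG2 n) D \<and> dimer_at D (outmost n 1) = b1 \<and>
     dimer_at D (outmost n 2) = b2 \<and> dimer_at D (outmost n 3) = b3}"

definition state_count :: "nat \<Rightarrow> bool \<Rightarrow> bool \<Rightarrow> bool \<Rightarrow> nat" where
  "state_count n b1 b2 b3 = card (state_configs n b1 b2 b3)"

text \<open>
  A vertex where two copies meet may be covered by a dimer in at most one of them. A pair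
  \<open>(a\<^sub>l\<^sub>m, a\<^sub>m\<^sub>l)\<close> records whether it is covered in copy \<open>l\<close> and in copy \<open>m\<close>.
\<close>

definition gluing_states :: "(bool \<times> bool) set" where
  "gluing_states = {(False, False), (True, False), (False, True)}"

lemma finite_state_configs: "finite (state_configs n b1 b2 b3)"
  by (rule finite_subset[OF _ finite_dm_configs[of n]]) (auto simp: state_configs_def)

text \<open>\<open>x1\<close>, \<open>x2\<close>, \<open>x3\<close> are the states at the outmost
  vertices of the larger graph. Each copy lists its states in the order of its own outmost vertices
  1, 2, 3. As a dependent product, the set has a product of three counts as its cardinality.\<close>

fun copy_states :: "nat \<Rightarrow> bool \<Rightarrow> bool \<Rightarrow> bool \<Rightarrow>
    (bool \<times> bool) \<times> (bool \<times> bool) \<times> (bool \<times> bool) \<Rightarrow> (nat \<Rightarrow> vertex set set) set" where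
  "copy_states n x1 x2 x3 ((a12, a21), (a13, a31), (a23, a32)) =
     (\<Pi>\<^sub>E l\<in>labels. if l = 1 then state_configs n x1 a12 a13
        else if l = 2 then state_configs n a21 x2 a23 else state_configs n a31 a32 x3)"

lemma mem_copy_states_iff:
  "X \<in> copy_states n x1 x2 x3 ((a12, a21), (a13, a31), (a23, a32)) \<longleftrightarrow>
     X \<in> extensional labels \<and> X 1 \<in> state_configs n x1 a12 a13 \<and>
     X 2 \<in> state_configs n a21 x2 a23 \<and> X 3 \<in> state_configs n a31 a32 x3"
  by (auto simp: PiE_iff labels_def)

text \<open>Compatibility excludes exactly the pair \<open>(True, True)\<close> at each gluing
  vertex, which leaves \<open>gluing_states\<close>.\<close>

lemma UN_copy_states:
  "(\<Union>p\<in>gluing_states \<times> gluing_states \<times> gluing_states. copy_states n x1 x2 x3 p) =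
     {X \<in> labels \<rightarrow>\<^sub>E {D. dm_config (SG2 n) D}. compatible n X \<and>
        dimer_at (X 1) (outmost n 1) = x1 \<and> dimer_at (X 2) (outmost n 2) = x2 \<and>
        dimer_at (X 3) (outmost n 3) = x3}"
    (is "?U = ?V")
proof (intro set_eqI)
  fix X
  have "X \<in> ?U \<longleftrightarrow> (\<exists>a12 a21 a13 a31 a23 a32. (a12, a21) \<in> gluing_states \<and>
      (a13, a31) \<in> gluing_states \<and> (a23, a32) \<in> gluing_states \<and>
      X \<in> copy_states n x1 x2 x3 ((a12, a21), (a13, a31), (a23, a32)))"
    unfolding UN_iff Bex_def split_paired_Ex mem_Times_iff fst_conv snd_conv by blast
  also have "\<dots> \<longleftrightarrow> X \<in> ?V"
    unfolding mem_copy_states_iff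
    by (auto simp: PiE_iff labels_def compatible_def gluing_states_def state_configs_def)
  finally show "X \<in> ?U \<longleftrightarrow> X \<in> ?V" .
qed

lemma state_configs_Suc:
  "state_configs (Suc n) x1 x2 x3 =
     join n ` (\<Union>p\<in>gluing_states \<times> gluing_states \<times> gluing_states. copy_states n x1 x2 x3 p)"
proof -
  let ?A = "{X \<in> labels \<rightarrow>\<^sub>E {D. dm_config (SG2 n) D}. compatible n X}"
  have "state_configs (Suc n) x1 x2 x3 =
      {D \<in> join n ` ?A. dimer_at D (outmost (Suc n) 1) = x1 \<and>
        dimer_at D (outmost (Suc n) 2) = x2 \<and> dimer_at D (outmost (Suc n) 3) = x3}"
    unfolding bij_betw_imp_surj_on[OF bij_betw_join] state_configs_def by blast
  also have "\<dots> = join n ` {X \<in> ?A. dimer_at (X 1) (outmost n 1) = x1 \<and>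
      dimer_at (X 2) (outmost n 2) = x2 \<and> dimer_at (X 3) (outmost n 3) = x3}"
    using dimer_at_join[of 1 n] dimer_at_join[of 2 n] dimer_at_join[of 3 n]
    by (auto simp: labels_def simp del: outmost.simps)
  finally show ?thesis
    unfolding UN_copy_states by (simp only: mem_Collect_eq conj_assoc)
qed

text \<open>\<open>join\<close> is injective on the union, and the pieces \<open>copy_states\<close>
  are disjoint because a triple of configurations determines all its states.\<close>

lemma state_count_Suc:
  "state_count (Suc n) x1 x2 x3 =
     (\<Sum>(a12, a21)\<in>gluing_states. \<Sum>(a13, a31)\<in>gluing_states. \<Sum>(a23, a32)\<in>gluing_states.
        state_count n x1 a12 a13 * state_count n a21 x2 a23 * state_count n a31 a32 x3)"
proof -
  let ?P = "gluing_states \<times> gluing_states \<times> gluing_states"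
  have fin: "finite (copy_states n x1 x2 x3 p)" for p
    by (cases p rule: prod.exhaust)
      (auto intro!: finite_PiE simp: finite_state_configs split: prod.splits)
  have finP: "finite ?P" by (simp add: gluing_states_def)
  have sub: "(\<Union>p\<in>?P. copy_states n x1 x2 x3 p) \<subseteq>
      {X \<in> labels \<rightarrow>\<^sub>E {D. dm_config (SG2 n) D}. compatible n X}"
    unfolding UN_copy_states by blast
  have "state_count (Suc n) x1 x2 x3 = card (\<Union>p\<in>?P. copy_states n x1 x2 x3 p)"
    unfolding state_count_def state_configs_Suc
    by (intro card_image inj_on_subset[OF bij_betw_imp_inj_on[OF bij_betw_join] sub])
  also have "\<dots> = (\<Sum>p\<in>?P. card (copy_states n x1 x2 x3 p))"
  proof (rule card_UN_disjoint[OF finP])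
    have "p = q" if "X \<in> copy_states n x1 x2 x3 p" "X \<in> copy_states n x1 x2 x3 q" for p q X
    proof -
      obtain a12 a21 a13 a31 a23 a32 where p: "p = ((a12, a21), (a13, a31), (a23, a32))"
        by (metis prod.exhaust)
      obtain b12 b21 b13 b31 b23 b32 where q: "q = ((b12, b21), (b13, b31), (b23, b32))"
        by (metis prod.exhaust)
      show "p = q"
        using that unfolding p q mem_copy_states_iff state_configs_def by simp
    qed
    then show "\<forall>p\<in>?P. \<forall>q\<in>?P. p \<noteq> q \<longrightarrow>
        copy_states n x1 x2 x3 p \<inter> copy_states n x1 x2 x3 q = {}"
      by blast
  qed (use fin in blast)
  also have "\<dots> = (\<Sum>((a12, a21), (a13, a31), (a23, a32))\<in>?P.
      state_count n x1 a12 a13 * state_count n a21 x2 a23 * state_count n a31 a32 x3)"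
    by (intro sum.cong)
      (auto simp: card_PiE state_count_def, auto simp: labels_def)
  finally show ?thesis
    by (simp add: sum.cartesian_product case_prod_unfold)
qed

section \<open>Initial values on the triangle\<close>

lemma dm_configs_triangle:
  "{D. dm_config (SG2 0) D} =
     {{}, {{Corner 1, Corner 2}}, {{Corner 1, Corner 3}}, {{Corner 2, Corner 3}}}"
proof -
  have E: "edges (SG2 0) = {{Corner 1, Corner 2}, {Corner 1, Corner 3}, {Corner 2, Corner 3}}"
    (is "_ = ?E")
  proof
    show "edges (SG2 0) \<subseteq> ?E"
    proof
      fix e assume "e \<in> edges (SG2 0)"
      then obtain l m where "e = {Corner l, Corner m}" "l \<in> labels" "m \<in> labels" "l \<noteq> m"
        by (auto simp: edges_def)
      then show "e \<in> ?E" by (auto simp: labels_def insert_commute)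
    qed
    have "{Corner l, Corner m} \<in> edges (SG2 0)" if "l \<in> labels" "m \<in> labels" "l \<noteq> m" for l m
      using that by (auto simp: edges_def)
    then show "?E \<subseteq> edges (SG2 0)" by (simp add: labels_def)
  qed
  \<comment> \<open>Any two edges of a triangle share a corner, so a configuration has at most one
    dimer.\<close>
  have meet: "e \<inter> e' \<noteq> {}" if "e \<in> ?E" "e' \<in> ?E" for e e'
    using that by fastforce
  have configs: "D \<subseteq> ?E \<and> (\<forall>e\<in>D. \<forall>e'\<in>D. e \<inter> e' \<noteq> {} \<longrightarrow> e = e') \<longleftrightarrow>
      D = {} \<or> (\<exists>e\<in>?E. D = {e})" for D
  proof
    assume D: "D \<subseteq> ?E \<and> (\<forall>e\<in>D. \<forall>e'\<in>D. e \<inter> e' \<noteq> {} \<longrightarrow> e = e')"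
    show "D = {} \<or> (\<exists>e\<in>?E. D = {e})"
    proof (cases "D = {}")
      case False
      then obtain e where e: "e \<in> D" by (meson ex_in_conv)
      have "e' = e" if "e' \<in> D" for e'
        using meet[of e' e] D e that by (meson subsetD)
      with e have "D = {e}" by (intro set_eqI) (metis singleton_iff)
      moreover have "e \<in> ?E" using D e by (meson subsetD)
      ultimately show ?thesis by (intro disjI2 bexI[of _ e])
    qed (rule disjI1)
  next
    assume "D = {} \<or> (\<exists>e\<in>?E. D = {e})"
    then show "D \<subseteq> ?E \<and> (\<forall>e\<in>D. \<forall>e'\<in>D. e \<inter> e' \<noteq> {} \<longrightarrow> e = e')"
      by (elim disjE bexE) (simp_all only: empty_subsetI empty_iff insert_subset singleton_iff
          ball_simps simp_thms)
  qed
  show ?thesis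
    unfolding dm_config_SG2_iff E configs
    by (rule set_eqI) (simp only: mem_Collect_eq insert_iff empty_iff bex_simps simp_thms)
qed

lemma Collect_insert_if:
  "{x \<in> insert a A. Q x} = (if Q a then insert a {x \<in> A. Q x} else {x \<in> A. Q x})"
  by auto

text \<open>The empty configuration covers no corner and a single dimer covers exactly two, so only
  these states occur, once each.\<close>

lemma state_count_0:
  "state_count 0 b1 b2 b3 =
     (if \<not> b1 \<and> \<not> b2 \<and> \<not> b3 \<or> b1 \<and> b2 \<and> \<not> b3 \<or> b1 \<and> \<not> b2 \<and> b3 \<or> \<not> b1 \<and> b2 \<and> b3
      then 1 else 0)"
proof -
  have "state_configs 0 b1 b2 b3 = {D \<in> {D. dm_config (SG2 0) D}.
      dimer_at D (Corner 1) = b1 \<and> dimer_at D (Corner 2) = b2 \<and> dimer_at D (Corner 3) = b3}"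
    by (auto simp: state_configs_def)
  then show ?thesis
    unfolding state_count_def dm_configs_triangle Collect_insert_if
    by (cases b1; cases b2; cases b3) (simp_all add: dimer_at_def)
qed

section \<open>Symmetry and the polynomial recursion\<close>

lemma sum_gluing_states:
  "(\<Sum>p\<in>gluing_states. F p) = F (False, False) + F (True, False) + F (False, True)"
  for F :: "bool \<times> bool \<Rightarrow> nat"
  by (simp add: gluing_states_def)

text \<open>Bundling the symmetry with the values lets the induction on \<open>n\<close> carry it as
  an invariant.\<close>

definition symmetric_counts :: "nat \<Rightarrow> nat \<Rightarrow> nat \<Rightarrow> nat \<Rightarrow> nat \<Rightarrow> bool" where
  "symmetric_counts n f g h t \<longleftrightarrow>
     state_count n False False False = f \<and>
     state_count n True False False = g \<and>
     state_count n False True False = g \<and>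
     state_count n False False True = g \<and>
     state_count n False True True = h \<and>
     state_count n True False True = h \<and>
     state_count n True True False = h \<and>
     state_count n True True True = t"

text \<open>The symmetry of the gasket is read off the recursion, without constructing automorphisms.\<close>

lemma symmetric_counts_Suc:
  assumes "symmetric_counts n f g h t"
  shows "symmetric_counts (Suc n)
    (f ^ 3 + 6 * f ^ 2 * g + 3 * f ^ 2 * h + 9 * f * g ^ 2
     + 2 * g ^ 3 + 6 * f * g * h)
    (f ^ 2 * g + 2 * f ^ 2 * h + 4 * f * g ^ 2 + f ^ 2 * t
     + 8 * f * g * h + 3 * g ^ 3 + 2 * f * g * t
     + 2 * f * h ^ 2 + 4 * g ^ 2 * h)
    (f * g ^ 2 + 4 * f * g * h + 2 * g ^ 3 + 2 * f * g * t
     + 7 * g ^ 2 * h + 3 * f * h ^ 2 + 2 * f * h * t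
     + 2 * g ^ 2 * t + 4 * g * h ^ 2)
    (g ^ 3 + 6 * g ^ 2 * h + 3 * g ^ 2 * t + 9 * g * h ^ 2
     + 2 * h ^ 3 + 6 * g * h * t)"
proof -
  note c = assms[unfolded symmetric_counts_def]
  show ?thesis
    unfolding symmetric_counts_def state_count_Suc sum_gluing_states prod.case
    \<comment> \<open>After substituting the eight known counts, each conjunct is a polynomial
      identity with 27 products on its left side.\<close>
    by (simp only: c, intro conjI; algebra)
qed

lemma symmetric_counts_0: "symmetric_counts 0 1 0 1 0"
  by (simp add: symmetric_counts_def state_count_0)

lemma ex_symmetric_counts: "\<exists>f g h t. symmetric_counts n f g h t"
proof (induction n)
  case 0
  show ?case using symmetric_counts_0 by blast
next
  case (Suc n)
  then show ?case using symmetric_counts_Suc by blast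
qed

section \<open>From state counts to the named quantities\<close>

lemma f2_eq:
  assumes "symmetric_counts n f g h t"
  shows "f2 n = f"
  using assms
  by (simp add: symmetric_counts_def f2_def state_count_def state_configs_def monomer_at_def
      labels_def)

lemma t2_eq:
  assumes "symmetric_counts n f g h t"
  shows "t2 n = t"
  using assms
  by (simp add: symmetric_counts_def t2_def state_count_def state_configs_def labels_def)

text \<open>Comparing \<open>i\<close> with 1, 2, 3 encodes the state with \<open>i\<close> as its
  only covered vertex, uniformly in \<open>i\<close>.\<close>

lemma g2_eq:
  assumes "symmetric_counts n f g h t" and "i \<in> labels"
  shows "g2 i n = g"
proof -
  have "g2 i n = state_count n (i = 1) (i = 2) (i = 3)"
    unfolding g2_def state_count_def state_configs_def monomer_at_def
    using assms(2) by (intro arg_cong[where f = card]) (auto simp: labels_def)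
  with assms show ?thesis by (auto simp: labels_def symmetric_counts_def)
qed

lemma h2_eq:
  assumes "symmetric_counts n f g h t" and "j \<in> labels"
  shows "h2 j n = h"
proof -
  have "h2 j n = state_count n (j \<noteq> 1) (j \<noteq> 2) (j \<noteq> 3)"
    unfolding h2_def state_count_def state_configs_def monomer_at_def
    using assms(2) by (intro arg_cong[where f = card]) (auto simp: labels_def)
  with assms show ?thesis by (auto simp: labels_def symmetric_counts_def)
qed

lemma M2_eq_sum_state_count:
  "M2 n = (\<Sum>(b1, b2, b3)\<in>UNIV. state_count n b1 b2 b3)"
proof -
  have "{D. dm_config (SG2 n) D} = (\<Union>p. case p of (b1, b2, b3) \<Rightarrow> state_configs n b1 b2 b3)"
    by (auto simp: state_configs_def)
  then have "M2 n = card (\<Union>p. case p of (b1, b2, b3) \<Rightarrow> state_configs n b1 b2 b3)"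
    by (simp add: M2_def N_DM_def)
  also have "\<dots> = (\<Sum>p\<in>UNIV. card (case p of (b1, b2, b3) \<Rightarrow> state_configs n b1 b2 b3))"
    by (rule card_UN_disjoint) (auto simp: finite_state_configs, auto simp: state_configs_def)
  finally show ?thesis by (simp add: state_count_def case_prod_unfold)
qed

lemma M2_eq:
  assumes "symmetric_counts n f g h t"
  shows "M2 n = f + 3 * g + 3 * h + t"
  using assms
  by (simp add: M2_eq_sum_state_count symmetric_counts_def UNIV_bool
      flip: UNIV_Times_UNIV sum.cartesian_product)

text \<open>The first formula is stated over \<open>int\<close> because subtraction on
  \<open>nat\<close> truncates. It has the shape of inclusion-exclusion over the gluing vertices
  covered from both sides: \<open>g + 2h + t\<close> counts configurations covering one given
  outmost vertex, and \<open>h + t\<close> those covering two given ones.\<close>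

theorem mainTheorem1:
  fixes n i j :: nat
  assumes "i \<in> labels" and "j \<in> labels"
  shows
    "int (M2 (n + 1)) =
       int (M2 n) ^ 3
       - 3 * int (M2 n) * (int (g2 i n) + 2 * int (h2 j n) + int (t2 n)) ^ 2
       + 3 * (int (h2 j n) + int (t2 n)) * (int (g2 i n) + 2 * int (h2 j n) + int (t2 n)) ^ 2
       - (int (h2 j n) + int (t2 n)) ^ 3 \<and>
     f2 (n + 1) =
       f2 n ^ 3 + 6 * f2 n ^ 2 * g2 i n + 3 * f2 n ^ 2 * h2 j n + 9 * f2 n * g2 i n ^ 2
       + 2 * g2 i n ^ 3 + 6 * f2 n * g2 i n * h2 j n \<and>
     g2 i (n + 1) =
       f2 n ^ 2 * g2 i n + 2 * f2 n ^ 2 * h2 j n + 4 * f2 n * g2 i n ^ 2 + f2 n ^ 2 * t2 n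
       + 8 * f2 n * g2 i n * h2 j n + 3 * g2 i n ^ 3 + 2 * f2 n * g2 i n * t2 n
       + 2 * f2 n * h2 j n ^ 2 + 4 * g2 i n ^ 2 * h2 j n \<and>
     h2 j (n + 1) =
       f2 n * g2 i n ^ 2 + 4 * f2 n * g2 i n * h2 j n + 2 * g2 i n ^ 3 + 2 * f2 n * g2 i n * t2 n
       + 7 * g2 i n ^ 2 * h2 j n + 3 * f2 n * h2 j n ^ 2 + 2 * f2 n * h2 j n * t2 n
       + 2 * g2 i n ^ 2 * t2 n + 4 * g2 i n * h2 j n ^ 2 \<and>
     t2 (n + 1) =
       g2 i n ^ 3 + 6 * g2 i n ^ 2 * h2 j n + 3 * g2 i n ^ 2 * t2 n + 9 * g2 i n * h2 j n ^ 2
       + 2 * h2 j n ^ 3 + 6 * g2 i n * h2 j n * t2 n"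
proof -
  obtain f g h t where c: "symmetric_counts n f g h t"
    using ex_symmetric_counts by blast
  note c' = symmetric_counts_Suc[OF c]
  show ?thesis
    unfolding Suc_eq_plus1[symmetric]
      f2_eq[OF c] g2_eq[OF c assms(1)] h2_eq[OF c assms(2)] t2_eq[OF c] M2_eq[OF c]
      f2_eq[OF c'] g2_eq[OF c' assms(1)] h2_eq[OF c' assms(2)] t2_eq[OF c'] M2_eq[OF c']
      of_nat_add of_nat_mult of_nat_power of_nat_numeral
    \<comment> \<open>The last four conjuncts agree literally after unfolding;
      \<open>algebra\<close> checks the one for \<open>M2\<close> as a polynomial identity in
      \<open>f\<close>, \<open>g\<close>, \<open>h\<close>, \<open>t\<close>.\<close>
    by (intro conjI refl) algebra
qed

end
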